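(* Let $(S,\le)$ be a finite lattice, let $F:S\to\mathbb{R}$ be a modular function, and let $Q=\arg\min_{s\in S}F(s)$ be its minimizer set. Then $Q$ is a decomposition-closed sublattice of $S$.
   Context: Let $(S,\le)$ be a finite (nonempty) lattice with meet $\wedge$ and join $\vee$. A function $F:S\to\mathbb{R}$ is modular if $F(s)+F(s')=F(s\wedge s')+F(s\vee s')$ for all $s,s'\in S$. The minimizer set of $F$ is $\arg\min_{s\in S}F(s)$, the set of all $s\in S$ at which $F$ attains its minimum over $S$. A sublattice is a nonempty subset closed under $\wedge$ and $\vee$ of $S$. For $a\le b$ in $S$, $[a,b]=\{x\in S: a\le x\le b\}$; a pair $s,s'\in[a,b]$ is a decomposition of $[a,b]$ if $s\wedge s'=a$ and $s\vee s'=b$. A sublattice $Q\subseteq S$ is decomposition closed if, whenever $a,b\in Q$ with $a\le b$ and $s,s'$ is a decomposition of $[a,b]$, both $s$ and $s'$ belong to $Q$. *)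

theory Defs
  imports Complex_Main
begin

definition modular_function :: "('a::lattice \<Rightarrow> real) \<Rightarrow> bool" where
  "modular_function F \<longleftrightarrow> (\<forall>s s'. F s + F s' = F (inf s s') + F (sup s s'))"

definition minimizer_set :: "('a \<Rightarrow> real) \<Rightarrow> 'a set" where
  "minimizer_set F = {s. is_arg_min F (\<lambda>_. True) s}"

definition sublattice :: "'a::lattice set \<Rightarrow> bool" where
  "sublattice Q \<longleftrightarrow> Q \<noteq> {} \<and> (\<forall>x\<in>Q. \<forall>y\<in>Q. inf x y \<in> Q \<and> sup x y \<in> Q)"

definition is_decomposition :: "'a::lattice \<Rightarrow> 'a \<Rightarrow> 'a \<Rightarrow> 'a \<Rightarrow> bool" where
  "is_decomposition a b s s' \<longleftrightarrow> s \<in> {a..b} \<and> s' \<in> {a..b} \<and> inf s s' = a \<and> sup s s' = b"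

definition decomposition_closed :: "'a::lattice set \<Rightarrow> bool" where
  "decomposition_closed Q \<longleftrightarrow>
    (\<forall>a\<in>Q. \<forall>b\<in>Q. \<forall>s s'. a \<le> b \<longrightarrow> is_decomposition a b s s' \<longrightarrow> s \<in> Q \<and> s' \<in> Q)"

end

theory Submission
  imports Defs
begin

text \<open>Both closure properties are the two directions of one equivalence,
  \<open>modular_minimizers_iff\<close>: forwards it gives closure under \<open>inf\<close> and
  \<open>sup\<close>, backwards closure under decompositions. Finiteness makes the set
  nonempty.\<close>

lemma mem_minimizer_set_iff: "s \<in> minimizer_set F \<longleftrightarrow> (\<forall>y. F s \<le> F y)"
  by (auto simp: minimizer_set_def is_arg_min_linorder)

lemma minimizer_set_nonempty:
  fixes F :: "'a::finite \<Rightarrow> real"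
  shows "minimizer_set F \<noteq> {}"
  using ex_is_arg_min_if_finite[of "UNIV :: 'a set" F]
  by (auto simp: minimizer_set_def)

text \<open>In the modular identity each side is at least \<open>2 * min F\<close>, with equality
  iff both of its arguments are minimizers.\<close>

lemma modular_minimizers_iff:
  assumes "modular_function F"
  shows "s \<in> minimizer_set F \<and> s' \<in> minimizer_set F \<longleftrightarrow>
    inf s s' \<in> minimizer_set F \<and> sup s s' \<in> minimizer_set F"
proof -
  have eq: "F s + F s' = F (inf s s') + F (sup s s')"
    using assms by (simp add: modular_function_def)
  show ?thesis
    \<comment> \<open>Minimality of one pair, tested at the members of the other, gives termwise
      inequalities; equal sums turn them into equalities.\<close>
    unfolding mem_minimizer_set_iff using eq by (smt (verit))
qed

theorem proposition1:
  fixes F :: "'a::{finite, lattice} \<Rightarrow> real" and Q :: "'a set"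
  assumes "modular_function F"
    and "Q = minimizer_set F"
  shows "sublattice Q \<and> decomposition_closed Q"
  using modular_minimizers_iff[OF assms(1)] minimizer_set_nonempty[of F]
  unfolding assms(2) sublattice_def decomposition_closed_def is_decomposition_def
  by blast

end
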